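(* Let $a<b$, $c<d$, let $q\ge 1$, and let $f:\Delta=[a,b]\times[c,d]\to\mathbb{R}$ be a partially differentiable mapping on $\Delta$. If $\left|\frac{\partial^2 f}{\partial t\partial s}\right|^q$ is a convex function on the co-ordinates on $\Delta$, then $$\left|f\left(\frac{a+b}{2},\frac{c+d}{2}\right)+\frac{1}{(b-a)(d-c)}\int_a^b\int_c^d f(x,y)\,dy\,dx-\frac{1}{d-c}\int_c^d f\left(\frac{a+b}{2},y\right)dy-\frac{1}{b-a}\int_a^b f\left(x,\frac{c+d}{2}\right)dx\right|$$ $$\le\frac{(b-a)(d-c)}{16}\left(\frac{\left|\frac{\partial^2 f}{\partial t\partial s}(a,c)\right|^q+\left|\frac{\partial^2 f}{\partial t\partial s}(b,c)\right|^q+\left|\frac{\partial^2 f}{\partial t\partial s}(a,d)\right|^q+\left|\frac{\partial^2 f}{\partial t\partial s}(b,d)\right|^q}{4}\right)^{\frac1q}.$$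
   Context: $\frac{\partial^2 f}{\partial t\partial s}$ denotes the second-order mixed partial derivative of $f$ with respect to its first variable ($t$) and its second variable ($s$), on $\Delta$. A function $g:\Delta=[a,b]\times[c,d]\to\mathbb{R}$ is called convex on the co-ordinates on $\Delta$ if for every $y\in[c,d]$ the partial mapping $g_y:[a,b]\to\mathbb{R}$, $g_y(u)=g(u,y)$, is convex, and for every $x\in[a,b]$ the partial mapping $g_x:[c,d]\to\mathbb{R}$, $g_x(v)=g(x,v)$, is convex. *)

theory Defs
  imports "HOL-Analysis.Analysis"
begin

text \<open>
  All notions are for a function on a rectangle \<open>A \<times> B\<close> and only depend on its values there:
  derivatives are taken within the side \<open>A\<close> or \<open>B\<close>, hence are one-sided at the boundary of the
  rectangle. The operators below return an unspecified value where the derivative does not exist,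
  so existence always has to be assumed separately.
\<close>

definition partial_fst :: "real set \<Rightarrow> (real \<times> real \<Rightarrow> real) \<Rightarrow> real \<times> real \<Rightarrow> real" where
  "partial_fst A f p = vector_derivative (\<lambda>t. f (t, snd p)) (at (fst p) within A)"

definition partial_snd :: "real set \<Rightarrow> (real \<times> real \<Rightarrow> real) \<Rightarrow> real \<times> real \<Rightarrow> real" where
  "partial_snd B f p = vector_derivative (\<lambda>s. f (fst p, s)) (at (snd p) within B)"

definition differentiable_in_fst_on ::
    "real set \<Rightarrow> real set \<Rightarrow> (real \<times> real \<Rightarrow> real) \<Rightarrow> bool" where
  "differentiable_in_fst_on A B f \<longleftrightarrow> (\<forall>y\<in>B. (\<lambda>t. f (t, y)) differentiable_on A)"

definition differentiable_in_snd_on ::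
    "real set \<Rightarrow> real set \<Rightarrow> (real \<times> real \<Rightarrow> real) \<Rightarrow> bool" where
  "differentiable_in_snd_on A B f \<longleftrightarrow> (\<forall>x\<in>A. (\<lambda>s. f (x, s)) differentiable_on B)"

definition partially_differentiable_on ::
    "real set \<Rightarrow> real set \<Rightarrow> (real \<times> real \<Rightarrow> real) \<Rightarrow> bool" where
  "partially_differentiable_on A B f \<longleftrightarrow>
     differentiable_in_fst_on A B f \<and> differentiable_in_snd_on A B f"

text \<open>
  \<open>\<partial>\<^sup>2f/\<partial>t\<partial>s\<close> is read as \<open>\<partial>/\<partial>t (\<partial>f/\<partial>s)\<close>, with \<open>t\<close> the first and \<open>s\<close> the second variable;
  no continuity of it and no equality with the other order is presupposed.
\<close>

definition mixed_partial ::
    "real set \<Rightarrow> real set \<Rightarrow> (real \<times> real \<Rightarrow> real) \<Rightarrow> real \<times> real \<Rightarrow> real" where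
  "mixed_partial A B f = partial_fst A (partial_snd B f)"

definition has_mixed_partial_on ::
    "real set \<Rightarrow> real set \<Rightarrow> (real \<times> real \<Rightarrow> real) \<Rightarrow> bool" where
  "has_mixed_partial_on A B f \<longleftrightarrow>
     differentiable_in_snd_on A B f \<and> differentiable_in_fst_on A B (partial_snd B f)"

definition coordinate_convex_on ::
    "real set \<Rightarrow> real set \<Rightarrow> (real \<times> real \<Rightarrow> real) \<Rightarrow> bool" where
  "coordinate_convex_on A B g \<longleftrightarrow>
     (\<forall>y\<in>B. convex_on A (\<lambda>u. g (u, y))) \<and> (\<forall>x\<in>A. convex_on B (\<lambda>v. g (x, v)))"

end

(* |f_ts| powr q is bounded by the bilinear interpolant of its corner values, and the
   tangent to z powr (1/q) at their mean A turns this into a bound of |f_ts| by a bilinear function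
   alpha + beta tau + gamma sigma + delta tau sigma of the offsets (tau, sigma) from the centre, with
   alpha = A powr (1/q). The left-hand side is the mean over the rectangle of the double difference G
   of f based at the centre. Integrating the bilinear bound twice bounds |G| without any continuity
   of f_ts; in the mean, the beta, gamma and delta terms vanish by oddness, and alpha |tau sigma|
   contributes (b - a)(d - c)/16 * alpha. *)
theory Submission
  imports Defs
begin

section \<open>Bounds on increments from bounds on derivatives\<close>

text \<open>Every derivative is Henstock-Kurzweil integrable with the expected integral, so a
  pointwise bound on \<open>g'\<close> integrates without any continuity assumption. The factor
  \<open>sgn (x - y)\<close> covers both orders of \<open>x\<close> and \<open>y\<close>, so that a
  base point inside the interval is allowed later.\<close>

lemma abs_diff_le_of_derivative_le:
  fixes g g' \<phi> \<phi>' :: "real \<Rightarrow> real"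
  assumes g: "\<And>t. t \<in> {l..u} \<Longrightarrow> (g has_real_derivative g' t) (at t within {l..u})"
    and \<phi>: "\<And>t. t \<in> {l..u} \<Longrightarrow> (\<phi> has_real_derivative \<phi>' t) (at t within {l..u})"
    and le: "\<And>t. t \<in> {l..u} \<Longrightarrow> \<bar>g' t\<bar> \<le> \<phi>' t"
    and xy: "x \<in> {l..u}" "y \<in> {l..u}"
  shows "\<bar>g x - g y\<bar> \<le> sgn (x - y) * (\<phi> x - \<phi> y)"
proof -
  have mono: "\<bar>g v - g w\<bar> \<le> \<phi> v - \<phi> w" if "w \<le> v" "w \<in> {l..u}" "v \<in> {l..u}" for v w
  proof -
    have sub: "{w..v} \<subseteq> {l..u}" using that by auto
    have G: "(g' has_integral (g v - g w)) {w..v}"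
      using sub by (intro fundamental_theorem_of_calculus \<open>w \<le> v\<close>)
        (auto simp: has_real_derivative_iff_has_vector_derivative[symmetric]
          intro!: has_field_derivative_subset[OF g])
    have P: "(\<phi>' has_integral (\<phi> v - \<phi> w)) {w..v}"
      using sub by (intro fundamental_theorem_of_calculus \<open>w \<le> v\<close>)
        (auto simp: has_real_derivative_iff_has_vector_derivative[symmetric]
          intro!: has_field_derivative_subset[OF \<phi>])
    have "norm (integral {w..v} g') \<le> integral {w..v} \<phi>'"
      using G P le sub by (intro Henstock_Kurzweil_Integration.integral_norm_bound_integral) auto
    then show ?thesis
      using integral_unique[OF G] integral_unique[OF P] by simp
  qed
  consider "x < y" | "x = y" | "y < x" by linarith
  then show ?thesis
    using mono[of x y] mono[of y x] xy by cases (auto simp: abs_minus_commute)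
qed

text \<open>The bilinear bound is integrated once in each variable: first along \<open>x\<close> for
  \<open>Fs\<close>, then along \<open>y\<close> for \<open>F x - F p\<close>. Each integration
  contributes one sign. The base point \<open>(p, r)\<close> is arbitrary because it is needed both
  at the centre and, for a Lipschitz estimate, at other points.\<close>

lemma abs_double_difference_le:
  fixes F Fs h :: "real \<Rightarrow> real \<Rightarrow> real"
  assumes Fs: "\<And>x y. x \<in> {a..b} \<Longrightarrow> y \<in> {c..d} \<Longrightarrow> (F x has_real_derivative Fs x y) (at y within {c..d})"
    and h: "\<And>x y. x \<in> {a..b} \<Longrightarrow> y \<in> {c..d} \<Longrightarrow>
              ((\<lambda>t. Fs t y) has_real_derivative h x y) (at x within {a..b})"
    and le: "\<And>x y. x \<in> {a..b} \<Longrightarrow> y \<in> {c..d} \<Longrightarrow>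
              \<bar>h x y\<bar> \<le> \<alpha> + \<beta> * (x - p) + \<gamma> * (y - r) + \<delta> * (x - p) * (y - r)"
    and p: "p \<in> {a..b}" and r: "r \<in> {c..d}" and x: "x \<in> {a..b}" and y: "y \<in> {c..d}"
  shows "\<bar>F x y - F p y - F x r + F p r\<bar>
    \<le> sgn (x - p) * sgn (y - r) * (\<alpha> * (x - p) * (y - r) + \<beta> / 2 * (x - p)^2 * (y - r)
       + \<gamma> / 2 * (x - p) * (y - r)^2 + \<delta> / 4 * (x - p)^2 * (y - r)^2)"
proof -
  \<comment> \<open>Antiderivative in \<open>t\<close> of the bilinear bound, normalized to vanish
    at \<open>t = p\<close>.\<close>
  let ?P = "\<lambda>s t. \<alpha> * (t - p) + \<beta> / 2 * (t - p)^2 + \<gamma> * (s - r) * (t - p) + \<delta> / 2 * (s - r) * (t - p)^2"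
  have *: "\<bar>Fs x s - Fs p s\<bar> \<le> sgn (x - p) * ?P s x" if s: "s \<in> {c..d}" for s
  proof -
    have "(?P s has_real_derivative \<alpha> + \<beta> * (t - p) + \<gamma> * (s - r) + \<delta> * (t - p) * (s - r)) (at t within {a..b})" for t
      by (auto intro!: derivative_eq_intros simp: field_simps power2_eq_square)
    from abs_diff_le_of_derivative_le[OF h[OF _ s] this le[OF _ s] x p]
    show ?thesis by simp
  qed
  \<comment> \<open>Antiderivative in \<open>s\<close> of \<open>sgn (x - p) * ?P s x\<close>,
    vanishing at \<open>s = r\<close>. The sign stays inside, since the bound on the derivative
    includes it.\<close>
  let ?Q = "\<lambda>s. sgn (x - p) * (\<alpha> * (x - p) * (s - r) + \<beta> / 2 * (x - p)^2 * (s - r)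
       + \<gamma> / 2 * (x - p) * (s - r)^2 + \<delta> / 4 * (x - p)^2 * (s - r)^2)"
  have D: "((\<lambda>s. F x s - F p s) has_real_derivative Fs x s - Fs p s) (at s within {c..d})" if "s \<in> {c..d}" for s
    using Fs[OF x that] Fs[OF p that] by (rule DERIV_diff)
  have "(?Q has_real_derivative sgn (x - p) * ?P s x) (at s within {c..d})" for s
    by (auto intro!: derivative_eq_intros simp: field_simps power2_eq_square)
  from abs_diff_le_of_derivative_le[OF D this * y r]
  show ?thesis by (simp add: algebra_simps)
qed

section \<open>From coordinate convexity of a power to a bilinear bound\<close>

text \<open>Concavity of \<open>z powr r\<close>: for \<open>x > 0\<close> this is weighted AM-GM
  for \<open>x\<close> and \<open>A\<close>, divided by \<open>A powr (1 - r)\<close>. At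
  \<open>x = 0\<close> it reduces to \<open>r * A powr r \<le> A powr r\<close>.\<close>

lemma powr_le_tangent:
  fixes x A r :: real
  assumes "0 \<le> x" "0 < A" "0 \<le> r" "r \<le> 1"
  shows "x powr r \<le> A powr r + r * A powr (r - 1) * (x - A)"
proof (cases "x = 0")
  case True
  have "A powr (r - 1) * A = A powr r"
    using assms by (simp add: mult.commute powr_mult_base)
  moreover have "r * A powr r \<le> 1 * A powr r"
    using assms by (intro mult_right_mono) auto
  ultimately show ?thesis
    using True by (simp add: mult.assoc)
next
  case False
  have "x powr r * A powr (1 - r) \<le> r * x + (1 - r) * A"
    using assms False by (intro Youngs_inequality_0) auto
  then have "x powr r * A powr (1 - r) * A powr (r - 1) \<le> (r * x + (1 - r) * A) * A powr (r - 1)"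
    by (intro mult_right_mono) auto
  moreover have "A powr (1 - r) * A powr (r - 1) = 1"
    using assms by (simp add: powr_add[symmetric])
  ultimately have "x powr r \<le> (r * x + (1 - r) * A) * A powr (r - 1)"
    by (simp add: mult.assoc)
  also have "\<dots> = A * A powr (r - 1) + r * A powr (r - 1) * (x - A)"
    by (simp add: algebra_simps)
  also have "A * A powr (r - 1) = A powr r"
    using assms by (simp add: powr_mult_base)
  finally show ?thesis .
qed

text \<open>Convexity in the second variable reduces the point to the two edges \<open>y = c\<close>
  and \<open>y = d\<close>; convexity in the first variable then reduces each edge to its
  corners.\<close>

lemma coordinate_convex_on_le_bilinear:
  fixes g :: "real \<times> real \<Rightarrow> real"
  assumes "a < b" "c < d" and cv: "coordinate_convex_on {a..b} {c..d} g"
    and x: "x \<in> {a..b}" and y: "y \<in> {c..d}"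
  defines "l \<equiv> (x - a) / (b - a)" and "m \<equiv> (y - c) / (d - c)"
  shows "g (x, y) \<le> (1 - l) * (1 - m) * g (a, c) + l * (1 - m) * g (b, c)
                     + (1 - l) * m * g (a, d) + l * m * g (b, d)"
proof -
  have l: "0 \<le> l" "l \<le> 1" "0 \<le> m" "m \<le> 1"
    using assms by (auto simp: l_def m_def)
  have xl: "(1 - l) *\<^sub>R a + l *\<^sub>R b = x" and ym: "(1 - m) *\<^sub>R c + m *\<^sub>R d = y"
  proof -
    have "(1 - l) * a + l * b = a + l * (b - a)" "(1 - m) * c + m * d = c + m * (d - c)"
      by (simp_all add: algebra_simps)
    then show "(1 - l) *\<^sub>R a + l *\<^sub>R b = x" "(1 - m) *\<^sub>R c + m *\<^sub>R d = y"
      using assms(1,2) by (simp_all add: l_def m_def)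
  qed
  have 1: "g (x, s) \<le> (1 - l) * g (a, s) + l * g (b, s)" if "s \<in> {c..d}" for s
    using convex_onD_Icc[of a b "\<lambda>u. g (u, s)" l] cv that l assms(1)
    unfolding xl by (auto simp: coordinate_convex_on_def)
  have "g (x, y) \<le> (1 - m) * g (x, c) + m * g (x, d)"
    using convex_onD_Icc[of c d "\<lambda>v. g (x, v)" m] cv x l assms(2)
    unfolding ym by (auto simp: coordinate_convex_on_def)
  also have "\<dots> \<le> (1 - m) * ((1 - l) * g (a, c) + l * g (b, c)) + m * ((1 - l) * g (a, d) + l * g (b, d))"
    using 1[of c] 1[of d] l assms(2) by (intro add_mono mult_left_mono) auto
  finally show ?thesis by (simp add: algebra_simps)
qed

text \<open>The corner mean \<open>A\<close> is also the value of the bilinear interpolant at the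
  centre. Taking the tangent there makes \<open>A powr (1 / q)\<close> the constant term, and an
  affine function of a bilinear one is again bilinear. The other coefficients can stay existential,
  as they will integrate to zero.\<close>

lemma abs_le_centred_bilinear:
  fixes h :: "real \<times> real \<Rightarrow> real"
  assumes "a < b" "c < d" "q \<ge> 1" and cv: "coordinate_convex_on {a..b} {c..d} (\<lambda>p. \<bar>h p\<bar> powr q)"
  defines "A \<equiv> (\<bar>h (a, c)\<bar> powr q + \<bar>h (b, c)\<bar> powr q + \<bar>h (a, d)\<bar> powr q + \<bar>h (b, d)\<bar> powr q) / 4"
  obtains \<beta> \<gamma> \<delta> where "\<And>x y. x \<in> {a..b} \<Longrightarrow> y \<in> {c..d} \<Longrightarrow>
    \<bar>h (x, y)\<bar> \<le> A powr (1 / q) + \<beta> * (x - (a + b) / 2) + \<gamma> * (y - (c + d) / 2)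
                   + \<delta> * (x - (a + b) / 2) * (y - (c + d) / 2)"
proof -
  define w where "w = b - a"
  define v where "v = d - c"
  have wv: "w > 0" "v > 0" using assms(1,2) by (auto simp: w_def v_def)
  define h1 h2 h3 h4 where hs: "h1 = \<bar>h (a, c)\<bar> powr q" "h2 = \<bar>h (b, c)\<bar> powr q"
    "h3 = \<bar>h (a, d)\<bar> powr q" "h4 = \<bar>h (b, d)\<bar> powr q"
  have pos: "h1 \<ge> 0" "h2 \<ge> 0" "h3 \<ge> 0" "h4 \<ge> 0" by (auto simp: hs)
  have A: "A = (h1 + h2 + h3 + h4) / 4" by (simp add: A_def hs)
  \<comment> \<open>Coefficients of the interpolant in centred offsets: the mean slopes in
    \<open>x\<close> and \<open>y\<close>, and the mixed second difference of the corner
    values.\<close>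
  define \<beta> where "\<beta> = (h2 + h4 - h1 - h3) / 2 / w"
  define \<gamma> where "\<gamma> = (h3 + h4 - h1 - h2) / 2 / v"
  define \<delta> where "\<delta> = (h1 + h4 - h2 - h3) / w / v"
  \<comment> \<open>Slope of the tangent to \<open>z powr (1 / q)\<close> at \<open>A\<close>. The
    tangent may be vertical at \<open>A = 0\<close>, but then all corner values are 0 and
    \<open>?L\<close> vanishes identically, so slope 0 serves.\<close>
  define k where "k = (if A = 0 then 0 else 1 / q * A powr (1 / q - 1))"
  have "\<bar>h (x, y)\<bar> \<le> A powr (1 / q) + (k * \<beta>) * (x - (a + b) / 2) + (k * \<gamma>) * (y - (c + d) / 2)
                   + (k * \<delta>) * (x - (a + b) / 2) * (y - (c + d) / 2)"
    if xy: "x \<in> {a..b}" "y \<in> {c..d}" for x y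
  proof -
    define \<tau> where "\<tau> = x - (a + b) / 2"
    define \<sigma> where "\<sigma> = y - (c + d) / 2"
    let ?L = "A + \<beta> * \<tau> + \<gamma> * \<sigma> + \<delta> * \<tau> * \<sigma>"
    have lm: "(x - a) / (b - a) = \<tau> / w + 1 / 2" "(y - c) / (d - c) = \<sigma> / v + 1 / 2"
      using wv by (simp_all add: \<tau>_def \<sigma>_def w_def v_def field_simps)
    have "\<bar>h (x, y)\<bar> powr q \<le> (1 - (\<tau> / w + 1 / 2)) * (1 - (\<sigma> / v + 1 / 2)) * h1
       + (\<tau> / w + 1 / 2) * (1 - (\<sigma> / v + 1 / 2)) * h2
       + (1 - (\<tau> / w + 1 / 2)) * (\<sigma> / v + 1 / 2) * h3 + (\<tau> / w + 1 / 2) * (\<sigma> / v + 1 / 2) * h4"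
      using coordinate_convex_on_le_bilinear[OF assms(1,2) cv xy] by (simp add: lm hs)
    also have "\<dots> = ?L"
      using wv unfolding A \<beta>_def \<gamma>_def \<delta>_def by (simp add: field_simps)
    finally have L: "\<bar>h (x, y)\<bar> powr q \<le> ?L" .
    have "\<bar>h (x, y)\<bar> = (\<bar>h (x, y)\<bar> powr q) powr (1 / q)"
      using \<open>q \<ge> 1\<close> by (simp add: powr_powr)
    also have "\<dots> \<le> ?L powr (1 / q)"
      using L \<open>q \<ge> 1\<close> by (intro powr_mono2) auto
    also have "\<dots> \<le> A powr (1 / q) + k * (?L - A)"
    proof (cases "A = 0")
      case True
      then have "h1 = 0" "h2 = 0" "h3 = 0" "h4 = 0" using pos by (auto simp: A)
      then show ?thesis by (simp add: A \<beta>_def \<gamma>_def \<delta>_def)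
    next
      case False
      then have "A > 0" using pos by (auto simp: A)
      moreover have "?L \<ge> 0" using L by (rule order_trans[rotated]) simp
      ultimately show ?thesis
        using powr_le_tangent[of ?L A "1 / q"] \<open>q \<ge> 1\<close> by (simp add: k_def)
    qed
    finally show ?thesis
      unfolding \<tau>_def[symmetric] \<sigma>_def[symmetric] by (simp add: algebra_simps)
  qed
  then show ?thesis by (rule that)
qed

section \<open>Averaging the double difference over the rectangle\<close>

text \<open>These two moments arise from \<open>sgn z * z\<close> and \<open>sgn z * z^2\<close>
  with \<open>z\<close> the offset from the midpoint. Splitting at the midpoint removes the absolute
  value; the halves add up in the first integral and cancel in the second, whose integrand is
  odd.\<close>

lemma has_integral_abs_centred:
  fixes a b :: real
  assumes "a \<le> b"
  shows "((\<lambda>x. \<bar>x - (a + b) / 2\<bar>) has_integral (b - a)^2 / 4) {a..b}"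
    and "((\<lambda>x. (x - (a + b) / 2) * \<bar>x - (a + b) / 2\<bar>) has_integral 0) {a..b}"
proof -
  define m where "m = (a + b) / 2"
  have m: "a \<le> m" "m \<le> b" using assms by (auto simp: m_def)
  have FTC: "(g' has_integral (g v - g u)) {u..v}"
    if "u \<le> v" "\<And>x. (g has_real_derivative g' x) (at x)" for g g' :: "real \<Rightarrow> real" and u v
    using that by (intro fundamental_theorem_of_calculus)
      (auto simp: has_real_derivative_iff_has_vector_derivative[symmetric] intro: has_field_derivative_at_within)
  have 1: "((\<lambda>x. x - m) has_integral ((v - m)^2 / 2 - (u - m)^2 / 2)) {u..v}" if "u \<le> v" for u v
    by (rule FTC[OF that]) (auto intro!: derivative_eq_intros)
  have 2: "((\<lambda>x. (x - m)^2) has_integral ((v - m)^3 / 3 - (u - m)^3 / 3)) {u..v}" if "u \<le> v" for u v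
    by (rule FTC[OF that]) (auto intro!: derivative_eq_intros)
  have "((\<lambda>x. \<bar>x - m\<bar>) has_integral (a - m)^2 / 2) {a..m}"
    using has_integral_neg[OF 1[OF m(1)]] by (rule has_integral_eq_rhs[OF has_integral_eq[rotated]]) auto
  moreover have "((\<lambda>x. \<bar>x - m\<bar>) has_integral (b - m)^2 / 2) {m..b}"
    using 1[OF m(2)] by (rule has_integral_eq_rhs[OF has_integral_eq[rotated]]) auto
  ultimately have "((\<lambda>x. \<bar>x - m\<bar>) has_integral ((a - m)^2 / 2 + (b - m)^2 / 2)) {a..b}"
    by (rule has_integral_combine[OF m])
  then show "((\<lambda>x. \<bar>x - (a + b) / 2\<bar>) has_integral (b - a)^2 / 4) {a..b}"
    unfolding m_def by (rule has_integral_eq_rhs) (simp add: field_simps power2_eq_square)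
  have "((\<lambda>x. (x - m) * \<bar>x - m\<bar>) has_integral (a - m)^3 / 3) {a..m}"
    using has_integral_neg[OF 2[OF m(1)]]
    by (rule has_integral_eq_rhs[OF has_integral_eq[rotated]]) (auto simp: power2_eq_square abs_if algebra_simps)
  moreover have "((\<lambda>x. (x - m) * \<bar>x - m\<bar>) has_integral (b - m)^3 / 3) {m..b}"
    using 2[OF m(2)] by (rule has_integral_eq_rhs[OF has_integral_eq[rotated]]) (auto simp: power2_eq_square)
  ultimately have "((\<lambda>x. (x - m) * \<bar>x - m\<bar>) has_integral ((a - m)^3 / 3 + (b - m)^3 / 3)) {a..b}"
    by (rule has_integral_combine[OF m])
  then show "((\<lambda>x. (x - (a + b) / 2) * \<bar>x - (a + b) / 2\<bar>) has_integral 0) {a..b}"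
    unfolding m_def by (rule has_integral_eq_rhs) (simp add: field_simps power3_eq_cube)
qed

text \<open>The bound integrates to \<open>\<alpha> * ((b - a)^2 / 4) * ((d - c)^2 / 4)\<close>, and
  division by the area gives the factor 1/16. Most of the work is integrability: \<open>F\<close> is
  only given as differentiable in \<open>y\<close> and continuous along the horizontal midline, so
  regularity in \<open>x\<close> of the inner integral must come from the bound on
  \<open>h\<close>.\<close>

lemma abs_midpoint_defect_le:
  fixes F Fs h :: "real \<Rightarrow> real \<Rightarrow> real"
  assumes ab: "a < b" and cd: "c < d"
    and Fs: "\<And>x y. x \<in> {a..b} \<Longrightarrow> y \<in> {c..d} \<Longrightarrow> (F x has_real_derivative Fs x y) (at y within {c..d})"
    and h: "\<And>x y. x \<in> {a..b} \<Longrightarrow> y \<in> {c..d} \<Longrightarrow>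
              ((\<lambda>t. Fs t y) has_real_derivative h x y) (at x within {a..b})"
    and le: "\<And>x y. x \<in> {a..b} \<Longrightarrow> y \<in> {c..d} \<Longrightarrow>
              \<bar>h x y\<bar> \<le> \<alpha> + \<beta> * (x - (a + b) / 2) + \<gamma> * (y - (c + d) / 2)
                        + \<delta> * (x - (a + b) / 2) * (y - (c + d) / 2)"
    and cont: "continuous_on {a..b} (\<lambda>x. F x ((c + d) / 2))"
  shows "\<bar>F ((a + b) / 2) ((c + d) / 2)
          + 1 / ((b - a) * (d - c)) * integral {a..b} (\<lambda>x. integral {c..d} (F x))
          - 1 / (d - c) * integral {c..d} (F ((a + b) / 2))
          - 1 / (b - a) * integral {a..b} (\<lambda>x. F x ((c + d) / 2))\<bar>
         \<le> (b - a) * (d - c) / 16 * \<alpha>"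
proof -
  define p r where "p = (a + b) / 2" and "r = (c + d) / 2"
  have p: "p \<in> {a..b}" and r: "r \<in> {c..d}" using ab cd by (auto simp: p_def r_def)
  note le = le[folded p_def r_def] and cont = cont[folded r_def]
  define G where "G x y = F x y - F p y - F x r + F p r" for x y
  \<comment> \<open>The bound on the double difference with the signs absorbed, grouped into an even
    and an odd factor in \<open>y - r\<close> so that the inner integral can be read off.\<close>
  define W where "W x y = (\<alpha> * \<bar>x - p\<bar> + \<beta> / 2 * ((x - p) * \<bar>x - p\<bar>)) * \<bar>y - r\<bar>
      + (\<gamma> / 2 * \<bar>x - p\<bar> + \<delta> / 4 * ((x - p) * \<bar>x - p\<bar>)) * ((y - r) * \<bar>y - r\<bar>)" for x y
  define H where "H x = integral {c..d} (G x)" for x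
  have sgn_self: "sgn z * z = \<bar>z\<bar>" for z :: real
    by (simp add: sgn_if)
  have sgn_sq: "sgn z * z^2 = z * \<bar>z\<bar>" for z :: real
    by (simp add: sgn_if power2_eq_square)
  have G_le_W: "\<bar>G x y\<bar> \<le> W x y" if "x \<in> {a..b}" "y \<in> {c..d}" for x y
  proof -
    have "\<bar>G x y\<bar> \<le> sgn (x - p) * sgn (y - r) * (\<alpha> * (x - p) * (y - r) + \<beta> / 2 * (x - p)^2 * (y - r)
       + \<gamma> / 2 * (x - p) * (y - r)^2 + \<delta> / 4 * (x - p)^2 * (y - r)^2)"
      unfolding G_def using Fs h le p r that by (rule abs_double_difference_le)
    also have "\<dots> = \<alpha> * (sgn (x - p) * (x - p)) * (sgn (y - r) * (y - r))
       + \<beta> / 2 * (sgn (x - p) * (x - p)^2) * (sgn (y - r) * (y - r))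
       + \<gamma> / 2 * (sgn (x - p) * (x - p)) * (sgn (y - r) * (y - r)^2)
       + \<delta> / 4 * (sgn (x - p) * (x - p)^2) * (sgn (y - r) * (y - r)^2)"
      by (simp only: distrib_left mult_ac)
    also have "\<dots> = W x y"
      unfolding sgn_sq sgn_self W_def by (simp add: algebra_simps)
    finally show ?thesis .
  qed
  have contF: "continuous_on {c..d} (F x)" if "x \<in> {a..b}" for x
    using Fs[OF that] by (meson DERIV_continuous_on)
  have contG: "continuous_on {c..d} (G x)" if "x \<in> {a..b}" for x
    unfolding G_def using contF[OF that] contF[OF p] by (intro continuous_intros)
  have intG: "G x integrable_on {c..d}" if "x \<in> {a..b}" for x
    using contG[OF that] by (rule integrable_continuous_interval)
  \<comment> \<open>A uniform bound on \<open>h\<close>, from the triangle inequality and offsets of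
    at most the side lengths.\<close>
  define M where "M = \<bar>\<alpha>\<bar> + \<bar>\<beta>\<bar> * (b - a) + \<bar>\<gamma>\<bar> * (d - c) + \<bar>\<delta>\<bar> * (b - a) * (d - c)"
  have M: "\<bar>h x y\<bar> \<le> M" if "x \<in> {a..b}" "y \<in> {c..d}" for x y
  proof -
    have d: "\<bar>x - p\<bar> \<le> b - a" "\<bar>y - r\<bar> \<le> d - c"
      using that p r by auto
    have "\<bar>h x y\<bar> \<le> \<bar>\<alpha> + \<beta> * (x - p) + \<gamma> * (y - r) + \<delta> * (x - p) * (y - r)\<bar>"
      using le[OF that] by linarith
    also have "\<dots> \<le> \<bar>\<alpha>\<bar> + \<bar>\<beta>\<bar> * \<bar>x - p\<bar> + \<bar>\<gamma>\<bar> * \<bar>y - r\<bar> + \<bar>\<delta>\<bar> * \<bar>x - p\<bar> * \<bar>y - r\<bar>"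
      unfolding abs_mult[symmetric] by linarith
    also have "\<dots> \<le> M"
      unfolding M_def using d ab cd by (intro add_mono mult_mono order_refl) auto
    finally show ?thesis .
  qed
  text \<open>Separate differentiability alone does not make the outer integrand continuous; this bound does.\<close>
  have G_lip: "\<bar>G x y - G x' y\<bar> \<le> M * (d - c) * \<bar>x - x'\<bar>"
    if x: "x \<in> {a..b}" "x' \<in> {a..b}" and y: "y \<in> {c..d}" for x x' y
  proof -
    \<comment> \<open>\<open>G x y - G x' y\<close> is the double difference of \<open>F\<close>
      based at \<open>(x', r)\<close>. The constant \<open>M\<close> is written as a bilinear bound
      centred there, with zero slopes.\<close>
    have "\<bar>h x y\<bar> \<le> M + 0 * (x - x') + 0 * (y - r) + 0 * (x - x') * (y - r)"
      if "x \<in> {a..b}" "y \<in> {c..d}" for x y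
      using M[OF that] by simp
    from abs_double_difference_le[OF Fs h this x(2) r x(1) y]
    have "\<bar>G x y - G x' y\<bar> \<le> M * (sgn (x - x') * (x - x')) * (sgn (y - r) * (y - r))"
      by (simp add: G_def algebra_simps)
    also have "\<dots> = M * \<bar>y - r\<bar> * \<bar>x - x'\<bar>"
      unfolding sgn_self by (simp add: mult_ac)
    also have "\<dots> \<le> M * (d - c) * \<bar>x - x'\<bar>"
      using M[OF p r] y r by (intro mult_right_mono mult_left_mono) auto
    finally show ?thesis .
  qed
  have "(M * (d - c) * (d - c))-lipschitz_on {a..b} H"
  proof (rule lipschitz_onI)
    fix x x' assume x: "x \<in> {a..b}" "x' \<in> {a..b}"
    have "norm (integral {c..d} (\<lambda>y. G x y - G x' y)) \<le> integral {c..d} (\<lambda>_. M * (d - c) * \<bar>x - x'\<bar>)"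
      using x G_lip[OF x]
      by (intro Henstock_Kurzweil_Integration.integral_norm_bound_integral integrable_diff intG) auto
    then show "dist (H x) (H x') \<le> M * (d - c) * (d - c) * dist x x'"
      using intG x cd by (simp add: H_def integral_diff dist_real_def mult_ac)
  qed (use M[OF p r] cd in auto)
  then have contH: "continuous_on {a..b} H"
    by (rule lipschitz_on_continuous_on)
  \<comment> \<open>The definition of \<open>G\<close> is solved for \<open>F x y\<close> and
    integrated in \<open>y\<close>; the part \<open>F x r - F p r\<close> is constant in
    \<open>y\<close>.\<close>
  have intF: "(F x has_integral (H x + integral {c..d} (F p) + (d - c) * F x r - (d - c) * F p r)) {c..d}"
    if "x \<in> {a..b}" for x
  proof -
    have "((\<lambda>y. G x y + F p y + (F x r - F p r)) has_integral
        (H x + integral {c..d} (F p) + (d - c) *\<^sub>R (F x r - F p r))) {c..d}"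
      unfolding H_def using intG[OF that] contF[OF p] cd has_integral_const_real[of "F x r - F p r" c d]
      by (intro has_integral_add) (auto intro: integrable_continuous_interval)
    then show ?thesis by (simp add: G_def algebra_simps)
  qed
  have "((\<lambda>x. H x + integral {c..d} (F p) + (d - c) * F x r - (d - c) * F p r) has_integral
     (integral {a..b} H + (b - a) *\<^sub>R integral {c..d} (F p)
       + (d - c) * integral {a..b} (\<lambda>x. F x r) - (b - a) *\<^sub>R ((d - c) * F p r))) {a..b}"
    using contH cont ab has_integral_const_real[of "integral {c..d} (F p)" a b]
      has_integral_const_real[of "(d - c) * F p r" a b]
    by (intro has_integral_add has_integral_diff has_integral_mult_right)
      (auto intro: integrable_continuous_interval)
  then have "((\<lambda>x. integral {c..d} (F x)) has_integral
     (integral {a..b} H + (b - a) *\<^sub>R integral {c..d} (F p)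
       + (d - c) * integral {a..b} (\<lambda>x. F x r) - (b - a) *\<^sub>R ((d - c) * F p r))) {a..b}"
    by (rule has_integral_eq[rotated]) (simp add: integral_unique[OF intF])
  note J = integral_unique[OF this]
  \<comment> \<open>The cancellation isolated as algebra: \<open>z\<close> is the centre value,
    \<open>I\<close> the integral of \<open>H\<close>, \<open>K\<close> and \<open>L\<close> the
    integrals along the two midlines, \<open>w\<close> and \<open>v\<close> the side
    lengths.\<close>
  have normalize: "z + 1 / (w * v) * (I + w * K + v * L - w * (v * z)) - 1 / v * K - 1 / w * L = I / (w * v)"
    if "w \<noteq> 0" "v \<noteq> 0" for w v z I K L :: real
    using that by (simp add: field_simps)
  have "F p r + 1 / ((b - a) * (d - c)) * integral {a..b} (\<lambda>x. integral {c..d} (F x))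
          - 1 / (d - c) * integral {c..d} (F p) - 1 / (b - a) * integral {a..b} (\<lambda>x. F x r)
     = integral {a..b} H / ((b - a) * (d - c))"
    unfolding J real_scaleR_def using ab cd by (intro normalize) auto
  moreover have "\<bar>integral {a..b} H\<bar> \<le> \<alpha> * ((b - a)^2 / 4) * ((d - c)^2 / 4)"
  proof -
    note absx = has_integral_abs_centred[OF less_imp_le[OF ab], folded p_def]
      and absy = has_integral_abs_centred[OF less_imp_le[OF cd], folded r_def]
    \<comment> \<open>The odd moment in \<open>y\<close> removes \<open>\<gamma>\<close> and
      \<open>\<delta>\<close> here; the odd moment in \<open>x\<close> removes
      \<open>\<beta>\<close> in \<open>W'\<close>.\<close>
    have W: "(W x has_integral ((\<alpha> * \<bar>x - p\<bar> + \<beta> / 2 * ((x - p) * \<bar>x - p\<bar>)) * ((d - c)^2 / 4)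
        + (\<gamma> / 2 * \<bar>x - p\<bar> + \<delta> / 4 * ((x - p) * \<bar>x - p\<bar>)) * 0)) {c..d}" for x
      unfolding W_def by (intro has_integral_add has_integral_mult_right absy)
    have "\<bar>H x\<bar> \<le> (\<alpha> * \<bar>x - p\<bar> + \<beta> / 2 * ((x - p) * \<bar>x - p\<bar>)) * ((d - c)^2 / 4)"
      if x: "x \<in> {a..b}" for x
    proof -
      have "norm (H x) \<le> integral {c..d} (W x)"
        unfolding H_def using intG[OF x] G_le_W[OF x] W
        by (intro Henstock_Kurzweil_Integration.integral_norm_bound_integral) auto
      then show ?thesis using integral_unique[OF W] by simp
    qed
    moreover have W': "((\<lambda>x. (\<alpha> * \<bar>x - p\<bar> + \<beta> / 2 * ((x - p) * \<bar>x - p\<bar>)) * ((d - c)^2 / 4)) has_integral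
        ((\<alpha> * ((b - a)^2 / 4) + \<beta> / 2 * 0) * ((d - c)^2 / 4))) {a..b}"
      by (intro has_integral_add has_integral_mult_right has_integral_mult_left absx)
    ultimately have "norm (integral {a..b} H) \<le> integral {a..b}
        (\<lambda>x. (\<alpha> * \<bar>x - p\<bar> + \<beta> / 2 * ((x - p) * \<bar>x - p\<bar>)) * ((d - c)^2 / 4))"
      using contH
      by (intro Henstock_Kurzweil_Integration.integral_norm_bound_integral)
        (auto intro: integrable_continuous_interval)
    then show ?thesis unfolding integral_unique[OF W'] by simp
  qed
  ultimately show ?thesis
    using ab cd unfolding p_def[symmetric] r_def[symmetric]
    by (simp add: abs_divide abs_mult divide_le_eq power2_eq_square mult_ac)
qed

section \<open>Application to the mixed partial derivative\<close>

theorem theorem9: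
  fixes a b c d q :: real and f :: "real \<times> real \<Rightarrow> real"
  assumes "a < b" and "c < d" and "q \<ge> 1"
    and "partially_differentiable_on {a..b} {c..d} f"
    and "has_mixed_partial_on {a..b} {c..d} f"
    and "coordinate_convex_on {a..b} {c..d} (\<lambda>p. \<bar>mixed_partial {a..b} {c..d} f p\<bar> powr q)"
  shows "\<bar>f ((a + b) / 2, (c + d) / 2)
          + 1 / ((b - a) * (d - c)) * integral {a..b} (\<lambda>x. integral {c..d} (\<lambda>y. f (x, y)))
          - 1 / (d - c) * integral {c..d} (\<lambda>y. f ((a + b) / 2, y))
          - 1 / (b - a) * integral {a..b} (\<lambda>x. f (x, (c + d) / 2))\<bar>
         \<le> (b - a) * (d - c) / 16
           * ((\<bar>mixed_partial {a..b} {c..d} f (a, c)\<bar> powr q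
              + \<bar>mixed_partial {a..b} {c..d} f (b, c)\<bar> powr q
              + \<bar>mixed_partial {a..b} {c..d} f (a, d)\<bar> powr q
              + \<bar>mixed_partial {a..b} {c..d} f (b, d)\<bar> powr q) / 4) powr (1 / q)"
proof -
  let ?h = "mixed_partial {a..b} {c..d} f"
  obtain \<beta> \<gamma> \<delta> where bound: "\<And>x y. x \<in> {a..b} \<Longrightarrow> y \<in> {c..d} \<Longrightarrow>
      \<bar>?h (x, y)\<bar> \<le> ((\<bar>?h (a, c)\<bar> powr q + \<bar>?h (b, c)\<bar> powr q + \<bar>?h (a, d)\<bar> powr q
                      + \<bar>?h (b, d)\<bar> powr q) / 4) powr (1 / q)
        + \<beta> * (x - (a + b) / 2) + \<gamma> * (y - (c + d) / 2)
        + \<delta> * (x - (a + b) / 2) * (y - (c + d) / 2)"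
    using abs_le_centred_bilinear[OF assms(1-3,6)] by metis
  \<comment> \<open>Existence of the derivative turns the operator's value into a genuine
    derivative, so its unspecified default never enters.\<close>
  have Fs: "((\<lambda>s. f (x, s)) has_real_derivative partial_snd {c..d} f (x, y)) (at y within {c..d})"
    if "x \<in> {a..b}" "y \<in> {c..d}" for x y
    using assms(5) that
    by (auto simp: has_mixed_partial_on_def differentiable_in_snd_on_def differentiable_on_def
        partial_snd_def has_real_derivative_iff_has_vector_derivative vector_derivative_works)
  have h: "((\<lambda>t. partial_snd {c..d} f (t, y)) has_real_derivative ?h (x, y)) (at x within {a..b})"
    if "x \<in> {a..b}" "y \<in> {c..d}" for x y
    using assms(5) that
    by (auto simp: has_mixed_partial_on_def differentiable_in_fst_on_def differentiable_on_def
        mixed_partial_def partial_fst_def[of "{a..b}"] has_real_derivative_iff_has_vector_derivative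
        vector_derivative_works)
  \<comment> \<open>Adding a function of \<open>x\<close> alone leaves the mixed derivative
    unchanged, so regularity along this line must come from differentiability of \<open>f\<close> in
    its first variable.\<close>
  have cont: "continuous_on {a..b} (\<lambda>x. f (x, (c + d) / 2))"
    using assms(2,4)
    by (auto simp: partially_differentiable_on_def differentiable_in_fst_on_def
        intro!: differentiable_imp_continuous_on)
  show ?thesis
    using abs_midpoint_defect_le[of a b c d "\<lambda>x y. f (x, y)", OF assms(1,2) Fs h bound cont] by simp
qed

end
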